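(* Let $f_1$ and $f_2$ be two functions on $\mathbb{R}^n$ which are simple and convex. Then their infimal-convolution $f_1\square f_2$ is also a simple and convex function, and $$(j^1f_1)\,\underline{\square}\,(j^1f_2)=j^1(f_1\square f_2).$$
   Context: All functions are smooth and finite-valued. A function $f$ on $\mathbb{R}^n$ is simple if its gradient map $\nabla f$ is a diffeomorphism of $\mathbb{R}^n$. The infimal-convolution is $(f_1\square f_2)(q)=\inf_{v\in\mathbb{R}^n}\{f_1(v)+f_2(q-v)\}$. The $1$-graph of $f$ is $j^1f=\{(f(q),q,\nabla f(q))\mid q\in\mathbb{R}^n\}\subset J^1(\mathbb{R}^n,\mathbb{R})=\mathbb{R}\times\mathbb{R}^n\times\mathbb{R}^n$ (coordinates $(u,q,p)$). The convolution of $L_1,L_2\subset J^1(\mathbb{R}^n,\mathbb{R})$ is $L_1\underline{\square}L_2=\{(u_1+u_2,q_1+q_2,p)\mid(u_i,q_i,p)\in L_i,\ i\in\{1,2\}\}$. *)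

theory Defs
  imports "HOL-Analysis.Analysis"
begin

text \<open>
  \<open>Ck k f\<close>: \<open>f\<close> is of class $C^k$ on the whole space. In finite dimension, the derivative of \<open>f\<close>
  is a $C^k$ map into the space of linear maps iff each of its evaluations
  \<open>x \<mapsto> Df(x) v\<close> is $C^k$, which avoids iterating the type of linear maps.
\<close>

primrec Ck :: "nat \<Rightarrow> ('a::euclidean_space \<Rightarrow> 'b::euclidean_space) \<Rightarrow> bool" where
  "Ck 0 f \<longleftrightarrow> continuous_on UNIV f"
| "Ck (Suc k) f \<longleftrightarrow>
     f differentiable_on UNIV \<and> (\<forall>v. Ck k (\<lambda>x. frechet_derivative f (at x) v))"

definition smooth :: "('a::euclidean_space \<Rightarrow> 'b::euclidean_space) \<Rightarrow> bool" where
  "smooth f \<longleftrightarrow> (\<forall>k. Ck k f)"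

definition diffeomorphism :: "('a::euclidean_space \<Rightarrow> 'a) \<Rightarrow> bool" where
  "diffeomorphism F \<longleftrightarrow> bij F \<and> smooth F \<and> smooth (inv F)"

text \<open>Meaningful only where \<open>f\<close> is differentiable; the gradient is then unique.\<close>

definition gradient :: "('a::euclidean_space \<Rightarrow> real) \<Rightarrow> 'a \<Rightarrow> 'a" where
  "gradient f x = (THE D. GDERIV f x :> D)"

lemma gradient_eq:
  assumes "GDERIV f x :> D"
  shows "gradient f x = D"
  unfolding gradient_def
proof (rule the_equality)
  show "GDERIV f x :> D" by (fact assms)
next
  fix E assume "GDERIV f x :> E"
  then have "(\<lambda>h. h \<bullet> E) = (\<lambda>h. h \<bullet> D)"
    using assms unfolding gderiv_def by (rule has_derivative_unique)
  then have "\<forall>h. h \<bullet> E = h \<bullet> D"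
    by (simp add: fun_eq_iff)
  then show "E = D"
    by (simp only: vector_eq_ldot)
qed

text \<open>Smoothness of \<open>f\<close> itself is not part of this predicate and is stated separately.\<close>

definition simple :: "('a::euclidean_space \<Rightarrow> real) \<Rightarrow> bool" where
  "simple f \<longleftrightarrow> diffeomorphism (gradient f)"

text \<open>
  The infimum is taken in the reals, so \<open>infconv f g q\<close> is the (finite) infimal convolution at
  \<open>q\<close> exactly when \<open>infconv_finite\<close> holds there; otherwise the true infimum is $-\infty$ and
  the value is meaningless.
\<close>

definition infconv ::
    "('a::euclidean_space \<Rightarrow> real) \<Rightarrow> ('a \<Rightarrow> real) \<Rightarrow> 'a \<Rightarrow> real" where
  "infconv f g q = (INF v. f v + g (q - v))"

definition infconv_finite ::
    "('a::euclidean_space \<Rightarrow> real) \<Rightarrow> ('a \<Rightarrow> real) \<Rightarrow> bool" where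
  "infconv_finite f g \<longleftrightarrow> (\<forall>q. bdd_below (range (\<lambda>v. f v + g (q - v))))"

definition one_graph :: "('a::euclidean_space \<Rightarrow> real) \<Rightarrow> (real \<times> 'a \<times> 'a) set" where
  "one_graph f = {(f q, q, gradient f q) | q. True}"

definition jet_conv ::
    "(real \<times> 'a \<times> 'a) set \<Rightarrow> (real \<times> 'a \<times> 'a) set \<Rightarrow> (real \<times> 'a::euclidean_space \<times> 'a) set" where
  "jet_conv L1 L2 =
     {(u1 + u2, q1 + q2, p) | u1 u2 q1 q2 p. (u1, q1, p) \<in> L1 \<and> (u2, q2, p) \<in> L2}"

end

theory Submission
  imports Defs
begin

text \<open>
  On the level of 1-graphs, convolution adds the positions that carry a common slope. Write
  \<open>G1\<close> and \<open>G2\<close> for the inverses of the two gradient maps, so that \<open>Gi p\<close> is the point where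
  \<open>fi\<close> has slope \<open>p\<close>. The left-hand side then consists of the points
  \<open>(f1 (G1 p) + f2 (G2 p), H p, p)\<close> with \<open>H p = G1 p + G2 p\<close>, and everything reduces to two claims:
  \<open>H\<close> is a diffeomorphism, and its inverse \<open>K\<close> is the gradient of the infimal convolution.

  \<^item> \<open>H\<close> is injective because a convex function with injective gradient has a strictly monotone
    gradient (\<open>injective_gradient_strict_mono\<close>), and strict monotonicity passes to the inverses
    and to their sum.
  \<^item> \<open>H\<close> is surjective because a convex function whose gradient takes every value is coercive
    (\<open>surjective_subgradient_coercive\<close>). Hence \<open>v \<mapsto> f1 v + f2 (q - v)\<close> has a minimum, and
    at a critical point both gradients equal some \<open>p\<close>, which means \<open>H p = q\<close>.
  \<^item> The derivative of \<open>H\<close> is injective. The derivatives of \<open>G1\<close> and \<open>G2\<close> are positive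
    semidefinite and injective, but without symmetry this would say little about their sum:
    rotations of the plane by opposite right angles add up to zero. Instead of the symmetry of
    the Hessian, the proof uses cyclic monotonicity along triangles, which already gives
    \<open>A h \<bullet> h = 0 \<Longrightarrow> A h = 0\<close> for each derivative \<open>A\<close>
    (\<open>three_cyclic_monotone_derivative_definite\<close>).
  \<^item> The inverse \<open>K\<close> is then smooth (\<open>smooth_inv\<close>): its derivative at \<open>y\<close> is the inverse of the
    derivative of \<open>H\<close> at \<open>K y\<close>, which Cramer's rule expresses through derivatives of \<open>H\<close> at \<open>K y\<close>,
    so every degree of regularity of \<open>K\<close> yields the next one.

  Adding the tangent inequalities of \<open>f1\<close> at \<open>G1 p\<close> and of \<open>f2\<close> at \<open>G2 p\<close>, which have the same
  slope, shows that the infimum at \<open>H p\<close> is \<open>f1 (G1 p) + f2 (G2 p)\<close>, and also that \<open>p\<close> is a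
  subgradient of the infimal convolution there. This gives convexity; the chain rule gives
  differentiability, with gradient \<open>K\<close>.
\<close>

section \<open>Calculus of \<open>Ck\<close> functions\<close>

lemma Ck_SucI:
  assumes "\<And>x. (f has_derivative f' x) (at x)"
    and "\<And>v. Ck k (\<lambda>x. f' x v)"
  shows "Ck (Suc k) f"
proof -
  have "frechet_derivative f (at x) = f' x" for x
    using frechet_derivative_at[OF assms(1)] by simp
  with assms show ?thesis
    by (auto simp: differentiable_on_def differentiable_def)
qed

lemma Ck_Suc_has_derivative:
  "Ck (Suc k) f \<Longrightarrow> (f has_derivative frechet_derivative f (at x)) (at x)"
  by (auto simp: differentiable_on_def frechet_derivative_works)

lemma Ck_Suc_imp_Ck: "Ck (Suc k) f \<Longrightarrow> Ck k f"
proof (induction k arbitrary: f)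
  case 0
  then show ?case by (auto intro: differentiable_imp_continuous_on)
next
  case (Suc k)
  show ?case
  proof (rule Ck_SucI)
    show "(f has_derivative frechet_derivative f (at x)) (at x)" for x
      using Suc.prems by (rule Ck_Suc_has_derivative)
    show "Ck k (\<lambda>x. frechet_derivative f (at x) v)" for v
      using Suc.prems by (auto intro: Suc.IH)
  qed
qed

lemma Ck_const: "Ck k (\<lambda>x. c)"
proof (induction k arbitrary: c)
  case (Suc k)
  then show ?case by (intro Ck_SucI[where f' = "\<lambda>x v. 0"]) auto
qed simp

lemma Ck_add: "Ck k f \<Longrightarrow> Ck k g \<Longrightarrow> Ck k (\<lambda>x. f x + g x)"
proof (induction k arbitrary: f g)
  case 0
  then show ?case by (simp add: continuous_on_add)
next
  case (Suc k)
  show ?case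
  proof (rule Ck_SucI)
    show "((\<lambda>x. f x + g x) has_derivative
        (\<lambda>v. frechet_derivative f (at x) v + frechet_derivative g (at x) v)) (at x)" for x
      using Suc.prems[THEN Ck_Suc_has_derivative] by (rule has_derivative_add)
    show "Ck k (\<lambda>x. frechet_derivative f (at x) v + frechet_derivative g (at x) v)" for v
      using Suc.prems by (auto intro: Suc.IH)
  qed
qed

lemma Ck_sum:
  "finite A \<Longrightarrow> (\<And>a. a \<in> A \<Longrightarrow> Ck k (f a)) \<Longrightarrow> Ck k (\<lambda>x. \<Sum>a\<in>A. f a x)"
  by (induction A rule: finite_induct) (auto intro: Ck_const Ck_add)

lemma Ck_bounded_linear:
  assumes "bounded_linear L"
  shows "Ck k f \<Longrightarrow> Ck k (\<lambda>x. L (f x))"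
proof (induction k arbitrary: f)
  case 0
  then show ?case using assms by (simp add: linear_continuous_on_compose bounded_linear.linear)
next
  case (Suc k)
  show ?case
  proof (rule Ck_SucI)
    show "((\<lambda>x. L (f x)) has_derivative (\<lambda>v. L (frechet_derivative f (at x) v))) (at x)" for x
      using assms Ck_Suc_has_derivative[OF Suc.prems] by (rule bounded_linear.has_derivative)
    show "Ck k (\<lambda>x. L (frechet_derivative f (at x) v))" for v
      using Suc.prems by (auto intro: Suc.IH)
  qed
qed

lemma Ck_componentwise:
  fixes f :: "'a::euclidean_space \<Rightarrow> 'b::euclidean_space"
  assumes "\<And>b. b \<in> Basis \<Longrightarrow> Ck k (\<lambda>x. f x \<bullet> b)"
  shows "Ck k f"
proof -
  have "Ck k (\<lambda>x. \<Sum>b\<in>Basis. (f x \<bullet> b) *\<^sub>R b)"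
    using assms by (intro Ck_sum Ck_bounded_linear[OF bounded_linear_scaleR_left]) auto
  then show ?thesis by (simp add: euclidean_representation)
qed

lemma Ck_scaleR:
  "Ck k r \<Longrightarrow> Ck k f \<Longrightarrow> Ck k (\<lambda>x. r x *\<^sub>R f x)"
proof (induction k arbitrary: r f)
  case 0
  then show ?case by (simp add: continuous_on_scaleR)
next
  case (Suc k)
  show ?case
  proof (rule Ck_SucI)
    show "((\<lambda>x. r x *\<^sub>R f x) has_derivative (\<lambda>v. r x *\<^sub>R frechet_derivative f (at x) v +
        frechet_derivative r (at x) v *\<^sub>R f x)) (at x)" for x
      using Suc.prems[THEN Ck_Suc_has_derivative] by (rule has_derivative_scaleR)
    show "Ck k (\<lambda>x. r x *\<^sub>R frechet_derivative f (at x) v +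
        frechet_derivative r (at x) v *\<^sub>R f x)" for v
      using Suc.prems Suc.prems[THEN Ck_Suc_imp_Ck] by (intro Ck_add Suc.IH) auto
  qed
qed

lemma Ck_mult:
  fixes f g :: "'a::euclidean_space \<Rightarrow> real"
  shows "Ck k f \<Longrightarrow> Ck k g \<Longrightarrow> Ck k (\<lambda>x. f x * g x)"
  using Ck_scaleR[of k f g] by simp

lemma Ck_prod:
  fixes f :: "'i \<Rightarrow> 'a::euclidean_space \<Rightarrow> real"
  shows "finite A \<Longrightarrow> (\<And>a. a \<in> A \<Longrightarrow> Ck k (f a)) \<Longrightarrow> Ck k (\<lambda>x. \<Prod>a\<in>A. f a x)"
  by (induction A rule: finite_induct) (auto intro: Ck_const Ck_mult)

lemma Ck_inverse:
  fixes f :: "'a::euclidean_space \<Rightarrow> real"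
  assumes "\<And>x. f x \<noteq> 0"
  shows "Ck k f \<Longrightarrow> Ck k (\<lambda>x. inverse (f x))"
proof (induction k)
  case 0
  then show ?case using assms by (simp add: continuous_on_inverse)
next
  case (Suc k)
  show ?case
  proof (rule Ck_SucI)
    show "((\<lambda>x. inverse (f x)) has_derivative
        (\<lambda>v. - (inverse (f x) * frechet_derivative f (at x) v * inverse (f x)))) (at x)" for x
      by (rule Deriv.has_derivative_inverse[OF assms Ck_Suc_has_derivative[OF Suc.prems]])
    have "Ck k (\<lambda>x. - (1::real) * (inverse (f x) * frechet_derivative f (at x) v * inverse (f x)))" for v
      using Suc.prems Suc.IH Ck_Suc_imp_Ck[OF Suc.prems] by (intro Ck_mult Ck_const) auto
    then show "Ck k (\<lambda>x. - (inverse (f x) * frechet_derivative f (at x) v * inverse (f x)))" for v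
      by simp
  qed
qed

text \<open>
  A derivative is linear in its direction, so \<open>Df(g x)(Dg(x) v)\<close> expands into a sum of products
  of the partial derivatives of \<open>f\<close>, taken at \<open>g x\<close> along a fixed direction, with the coordinates
  of \<open>Dg(x) v\<close>. To such partial derivatives the induction hypothesis applies, since it ranges over
  all \<open>f\<close>.
\<close>

lemma Ck_compose:
  fixes g :: "'a::euclidean_space \<Rightarrow> 'b::euclidean_space"
    and f :: "'b \<Rightarrow> 'c::euclidean_space"
  shows "Ck k f \<Longrightarrow> Ck k g \<Longrightarrow> Ck k (\<lambda>x. f (g x))"
proof (induction k arbitrary: f)
  case 0
  then show ?case by (auto intro: continuous_on_compose2)
next
  case (Suc k)
  let ?Df = "\<lambda>y. frechet_derivative f (at y)" and ?Dg = "\<lambda>x. frechet_derivative g (at x)"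
  note df = Ck_Suc_has_derivative[OF Suc.prems(1)] and dg = Ck_Suc_has_derivative[OF Suc.prems(2)]
  have chain: "?Df (g x) (?Dg x v) = (\<Sum>b\<in>Basis. (?Dg x v \<bullet> b) *\<^sub>R ?Df (g x) b)" for x v
  proof -
    have "?Df (g x) (\<Sum>b\<in>Basis. (?Dg x v \<bullet> b) *\<^sub>R b) = (\<Sum>b\<in>Basis. (?Dg x v \<bullet> b) *\<^sub>R ?Df (g x) b)"
      using has_derivative_linear[OF df] by (simp add: linear_sum linear_scale)
    then show ?thesis by (simp add: euclidean_representation)
  qed
  show ?case
  proof (rule Ck_SucI)
    show "((\<lambda>x. f (g x)) has_derivative (\<lambda>v. ?Df (g x) (?Dg x v))) (at x)" for x
      using dg df by (rule has_derivative_compose)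
    show "Ck k (\<lambda>x. ?Df (g x) (?Dg x v))" for v
      unfolding chain
    proof (intro Ck_sum Ck_scaleR)
      show "Ck k (\<lambda>x. ?Dg x v \<bullet> b)" for b
        using Suc.prems(2) by (intro Ck_bounded_linear[OF bounded_linear_inner_left]) auto
      show "Ck k (\<lambda>x. ?Df (g x) b)" for b
        using Suc.prems(1) Ck_Suc_imp_Ck[OF Suc.prems(2)] by (intro Suc.IH) auto
    qed simp
  qed
qed

section \<open>Inverses of smooth maps\<close>

lemma Ck_det:
  fixes A :: "'a::euclidean_space \<Rightarrow> real^'n^'n"
  assumes "\<And>i j. Ck k (\<lambda>x. A x $ i $ j)"
  shows "Ck k (\<lambda>x. det (A x))"
  unfolding det_def
  by (intro Ck_sum Ck_mult Ck_const Ck_prod assms) (auto simp: finite_permutations)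

text \<open>
  By Cramer's rule the coordinates of the solution are quotients of determinants, hence rational
  functions of the entries of \<open>A x\<close>.
\<close>

lemma Ck_linear_solve:
  fixes A :: "'a::euclidean_space \<Rightarrow> real^'n \<Rightarrow> real^'n"
  assumes A: "\<And>v. Ck k (\<lambda>x. A x v)"
    and lin: "\<And>x. linear (A x)" and ker: "\<And>x h. A x h = 0 \<Longrightarrow> h = 0"
    and u: "\<And>x. A x (u x) = b"
  shows "Ck k u"
proof (rule Ck_componentwise)
  fix e :: "real^'n" assume "e \<in> Basis"
  then obtain m where e: "e = axis m 1" by (auto simp: Basis_vec_def)
  let ?M = "\<lambda>x. matrix (A x)"
  let ?C = "\<lambda>x. \<chi> i j. if j = m then b $ i else ?M x $ i $ j"
  have entry: "Ck k (\<lambda>x. ?M x $ i $ j)" for i j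
    using Ck_bounded_linear[OF bounded_linear_vec_nth A] by (simp add: matrix_def)
  have det: "det (?M x) \<noteq> 0" for x
  proof -
    have "inj (A x)" using ker by (simp add: linear_injective_0[OF lin])
    then have "inj ((*v) (?M x))" using lin by (simp add: matrix_works linear_matrix_vector_mul_eq)
    then show ?thesis
      by (metis invertible_det_nz invertible_left_inverse matrix_left_invertible_injective)
  qed
  have "u x $ m = det (?C x) * inverse (det (?M x))" for x
  proof -
    have "?M x *v u x = b" using u lin by (simp add: matrix_works)
    then show ?thesis using cramer[OF det] by (simp add: divide_inverse)
  qed
  moreover have "Ck k (\<lambda>x. det (?C x) * inverse (det (?M x)))"
  proof (intro Ck_mult Ck_det Ck_inverse det entry)
    show "Ck k (\<lambda>x. ?C x $ i $ j)" for i j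
      using entry by (cases "j = m") (simp_all add: Ck_const)
  qed
  ultimately show "Ck k (\<lambda>x. u x \<bullet> e)" by (simp add: e inner_axis)
qed

text \<open>
  Differentiability of the inverse is the inverse function theorem. The derivative of \<open>inv H\<close>
  in direction \<open>v\<close> solves a linear system with matrix \<open>DH\<close> at \<open>inv H y\<close> and right-hand side \<open>v\<close>.
  If \<open>inv H\<close> is \<open>Ck k\<close>, so is this matrix, hence so is the solution, and \<open>inv H\<close> is \<open>Ck (Suc k)\<close>.
\<close>

lemma smooth_inv:
  fixes H :: "real^'n \<Rightarrow> real^'n"
  assumes H: "smooth H" and bij: "bij H"
    and ker: "\<And>x h. frechet_derivative H (at x) h = 0 \<Longrightarrow> h = 0"
  shows "smooth (inv H)"
proof -
  let ?K = "inv H" and ?D = "\<lambda>x. frechet_derivative H (at x)"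
  have Ck: "Ck k H" for k using H by (simp add: smooth_def)
  note dH = Ck_Suc_has_derivative[OF Ck]
  have lin: "linear (?D x)" for x by (rule has_derivative_linear[OF dH])
  have bijD: "bij (?D x)" for x
    using ker lin[of x] linear_injective_imp_surjective[of "?D x"]
    by (auto simp: bij_def linear_injective_0)
  have dK: "(?K has_derivative inv (?D (?K y))) (at y)" for y
  proof -
    have "(?K has_derivative inv (?D (?K y))) (at (H (?K y)))"
    proof (rule has_derivative_inverse_strong[OF open_UNIV UNIV_I _ _ dH])
      show "continuous_on UNIV H" using Ck[of 0] by simp
      show "?K (H x) = x" for x using bij by (simp add: bij_is_inj)
      show "?D (?K y) \<circ> inv (?D (?K y)) = id" by (rule surj_iff[THEN iffD1, OF bij_is_surj[OF bijD]])
    qed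
    then show ?thesis using bij by (simp add: bij_is_surj surj_f_inv_f)
  qed
  have "Ck k ?K" for k
  proof (induction k)
    case 0
    show ?case using dK by (auto intro!: continuous_at_imp_continuous_on has_derivative_continuous)
  next
    case (Suc k)
    show ?case
    proof (rule Ck_SucI[OF dK])
      fix v
      show "Ck k (\<lambda>y. inv (?D (?K y)) v)"
      proof (rule Ck_linear_solve)
        show "Ck k (\<lambda>y. ?D (?K y) w)" for w
          using Ck[of "Suc k"] Suc.IH
          by (intro Ck_compose[where f = "\<lambda>p. ?D p w" and g = ?K]) auto
        show "?D (?K y) (inv (?D (?K y)) v) = v" for y
          using bijD by (simp add: bij_is_surj surj_f_inv_f)
      qed (use lin ker in auto)
    qed
  qed
  then show ?thesis by (simp add: smooth_def)
qed

section \<open>Convex functions and their gradients\<close>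

lemma smooth_imp_GDERIV:
  assumes "smooth f"
  shows "GDERIV f x :> gradient f x"
proof -
  let ?L = "frechet_derivative f (at x)"
  have "Ck 1 f" using assms by (simp add: smooth_def)
  then have d: "(f has_derivative ?L) (at x)"
    by (auto simp: differentiable_on_def frechet_derivative_works)
  have "?L = (\<lambda>h. h \<bullet> (\<Sum>b\<in>Basis. ?L b *\<^sub>R b))"
  proof
    fix h
    have "?L (\<Sum>b\<in>Basis. (h \<bullet> b) *\<^sub>R b) = (\<Sum>b\<in>Basis. (h \<bullet> b) *\<^sub>R ?L b)"
      using has_derivative_linear[OF d] by (simp add: linear_sum linear_scale)
    then show "?L h = h \<bullet> (\<Sum>b\<in>Basis. ?L b *\<^sub>R b)"
      by (simp add: euclidean_representation inner_sum_right mult.commute)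
  qed
  with d have "GDERIV f x :> (\<Sum>b\<in>Basis. ?L b *\<^sub>R b)"
    unfolding gderiv_def by (rule has_derivative_eq_rhs)
  then show ?thesis by (simp only: gradient_eq)
qed

lemma convex_above_tangent:
  assumes convex: "convex_on UNIV f" and d: "GDERIV f x :> d"
  shows "f x + d \<bullet> (y - x) \<le> f y"
proof -
  let ?l = "\<lambda>t::real. x + t *\<^sub>R (y - x)"
  have conv: "convex_on UNIV (\<lambda>t. f (?l t))"
  proof (rule convex_onI)
    fix t a b :: real assume t: "0 < t" "t < 1"
    have "?l ((1 - t) *\<^sub>R a + t *\<^sub>R b) = (1 - t) *\<^sub>R ?l a + t *\<^sub>R ?l b"
      by (simp add: algebra_simps)
    then show "f (?l ((1 - t) *\<^sub>R a + t *\<^sub>R b)) \<le> (1 - t) * f (?l a) + t * f (?l b)"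
      using convex_onD[OF convex, of t "?l a" "?l b"] t by simp
  qed simp
  have "(?l has_derivative (\<lambda>t. t *\<^sub>R (y - x))) (at 0)"
    by (auto intro!: derivative_eq_intros)
  moreover have "(f has_derivative (\<lambda>h. h \<bullet> d)) (at (?l 0))"
    using d by (simp add: gderiv_def)
  ultimately have "((\<lambda>t. f (?l t)) has_derivative (\<lambda>t. (t *\<^sub>R (y - x)) \<bullet> d)) (at 0)"
    by (rule has_derivative_compose)
  then have "((\<lambda>t. f (?l t)) has_real_derivative d \<bullet> (y - x)) (at 0)"
    by (rule has_derivative_imp_has_field_derivative) (simp add: inner_commute)
  from convex_on_imp_above_tangent[OF conv _ _ _ this, of 1] show ?thesis by simp
qed

lemma subgradients_imp_convex:
  fixes f :: "'a::real_inner \<Rightarrow> real"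
  assumes "\<And>x y. f x + g x \<bullet> (y - x) \<le> f y"
  shows "convex_on UNIV f"
proof (rule convex_onI)
  fix t :: real and x y :: 'a assume t: "0 < t" "t < 1"
  let ?z = "(1 - t) *\<^sub>R x + t *\<^sub>R y"
  have "x - ?z = t *\<^sub>R (x - y)" "y - ?z = (1 - t) *\<^sub>R (y - x)"
    by (simp_all add: algebra_simps)
  with assms[of ?z x] assms[of ?z y]
  have "f ?z + t * (g ?z \<bullet> (x - y)) \<le> f x" "f ?z + (1 - t) * (g ?z \<bullet> (y - x)) \<le> f y"
    by simp_all
  then have "(1 - t) * (f ?z + t * (g ?z \<bullet> (x - y))) + t * (f ?z + (1 - t) * (g ?z \<bullet> (y - x)))
      \<le> (1 - t) * f x + t * f y"
    using t by (intro add_mono mult_left_mono) auto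
  then show "f ?z \<le> (1 - t) * f x + t * f y"
    by (simp add: algebra_simps inner_diff_right)
qed simp

text \<open>
  If monotonicity is not strict at \<open>x\<close>, \<open>y\<close>, then the tangent at \<open>x\<close> also touches \<open>f\<close> at \<open>y\<close>.
  So \<open>f z - g x \<bullet> z\<close>, which is minimal at \<open>z = x\<close>, is minimal at \<open>z = y\<close> too, and its
  derivative \<open>g y - g x\<close> there vanishes.
\<close>

lemma injective_gradient_strict_mono:
  assumes tangent: "\<And>x y. f x + g x \<bullet> (y - x) \<le> f y" and d: "\<And>x. GDERIV f x :> g x"
    and "inj g" and "x \<noteq> y"
  shows "0 < (g x - g y) \<bullet> (x - y)"
proof (rule ccontr)
  assume "\<not> ?thesis"
  with tangent[of x y] tangent[of y x] have eq: "f x + g x \<bullet> (y - x) = f y"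
    by (simp add: inner_diff_left inner_diff_right)
  have "((\<lambda>z. f z - g x \<bullet> z) has_derivative (\<lambda>h. h \<bullet> g y - g x \<bullet> h)) (at y)"
    using d[of y] unfolding gderiv_def by (auto intro!: derivative_eq_intros)
  moreover have "f y - g x \<bullet> y \<le> f z - g x \<bullet> z" for z
    using tangent[of x z] eq by (simp add: inner_diff_right)
  ultimately have "(\<lambda>h. h \<bullet> g y - g x \<bullet> h) = (\<lambda>h. 0)"
    by (intro differential_zero_maxmin[OF UNIV_I open_UNIV]) auto
  then have "(g y - g x) \<bullet> (g y - g x) = 0"
    by (metis inner_commute inner_diff_right)
  then have "g x = g y" by simp
  then show False using \<open>inj g\<close> \<open>x \<noteq> y\<close> by (simp add: inj_eq)
qed

text \<open>
  The tangent with slope \<open>p\<close> reads \<open>f x \<ge> p \<bullet> x - c p\<close>, where \<open>c p = p \<bullet> G p - f (G p)\<close>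
  is the convex conjugate of \<open>f\<close> at \<open>p\<close>. It is continuous, thus bounded on the unit ball, and the
  choice of the unit vector \<open>p\<close> in direction \<open>x\<close> gives growth like \<open>norm x\<close>.
\<close>

lemma surjective_subgradient_coercive:
  fixes f :: "'a::euclidean_space \<Rightarrow> real"
  assumes tangent: "\<And>x y. f x + g x \<bullet> (y - x) \<le> f y" and G: "\<And>p. g (G p) = p"
    and "continuous_on UNIV f" and "continuous_on UNIV G"
  obtains c where "\<And>x. norm x - c \<le> f x"
proof -
  let ?conj = "\<lambda>p. p \<bullet> G p - f (G p)"
  have "continuous_on UNIV (\<lambda>p. f (G p))"
    using assms(3,4) by (rule continuous_on_compose2) simp
  then have "continuous_on UNIV ?conj"
    using assms(4) by (intro continuous_on_diff continuous_on_inner continuous_on_id)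
  then have "continuous_on (cball 0 1) ?conj"
    by (rule continuous_on_subset) simp
  then have "bdd_above (?conj ` cball 0 1)"
    by (intro bounded_imp_bdd_above compact_imp_bounded compact_continuous_image) auto
  then obtain c where c: "\<forall>p\<in>cball 0 1. ?conj p \<le> c"
    by (auto simp: bdd_above_def)
  have "norm x - c \<le> f x" for x
  proof -
    have "sgn x \<bullet> x = norm x"
      by (cases "x = 0") (simp_all add: sgn_div_norm dot_square_norm power2_eq_square)
    moreover have "?conj (sgn x) \<le> c" using c by (simp add: norm_sgn)
    ultimately show ?thesis
      using tangent[of "G (sgn x)" x] by (simp add: G inner_diff_right)
  qed
  then show ?thesis by (rule that)
qed

text \<open>
  The two gradients agree where \<open>f1 v + f2 (q - v)\<close> is minimal; coercivity confines the search for
  a minimum to a ball.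
\<close>

lemma infconv_critical_point_exists:
  fixes f1 f2 :: "'a::euclidean_space \<Rightarrow> real"
  assumes d1: "\<And>x. GDERIV f1 x :> g1 x" and d2: "\<And>x. GDERIV f2 x :> g2 x"
    and c1: "\<And>x. norm x - c1 \<le> f1 x" and c2: "\<And>x. norm x - c2 \<le> f2 x"
  shows "\<exists>v. g1 v = g2 (q - v)"
proof -
  let ?\<phi> = "\<lambda>v. f1 v + f2 (q - v)"
  have d: "(?\<phi> has_derivative (\<lambda>h. h \<bullet> (g1 v - g2 (q - v)))) (at v)" for v
  proof -
    have "((\<lambda>v. q - v) has_derivative (\<lambda>h. - h)) (at v)"
      by (auto intro!: derivative_eq_intros)
    from has_derivative_compose[OF this d2[of "q - v", unfolded gderiv_def]]
    show ?thesis
      using d1[of v] unfolding gderiv_def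
      by (auto intro!: derivative_eq_intros simp: inner_diff_right)
  qed
  let ?B = "cball (0::'a) (max 0 (?\<phi> 0 + c1 + c2))"
  have "continuous_on ?B ?\<phi>"
    using d by (auto intro!: continuous_at_imp_continuous_on has_derivative_continuous)
  then have "\<exists>v\<in>?B. \<forall>w\<in>?B. ?\<phi> v \<le> ?\<phi> w"
    by (intro continuous_attains_inf) auto
  then obtain v where v: "\<And>w. w \<in> ?B \<Longrightarrow> ?\<phi> v \<le> ?\<phi> w" by blast
  have "?\<phi> v \<le> ?\<phi> w" for w
  proof (cases "w \<in> ?B")
    case False
    then have "?\<phi> 0 + c1 + c2 < norm w" by simp
    moreover have "norm w - c1 - c2 \<le> ?\<phi> w"
      using c1[of w] c2[of "q - w"] norm_ge_zero[of "q - w"] by linarith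
    moreover have "?\<phi> v \<le> ?\<phi> 0" by (rule v) simp
    ultimately show ?thesis by linarith
  qed (rule v)
  then have "(\<lambda>h. h \<bullet> (g1 v - g2 (q - v))) = (\<lambda>h. 0)"
    by (intro differential_zero_maxmin[OF UNIV_I open_UNIV d]) auto
  then have "(g1 v - g2 (q - v)) \<bullet> (g1 v - g2 (q - v)) = 0" by meson
  then show ?thesis by auto
qed

section \<open>Derivatives of cyclically monotone maps\<close>

text \<open>
  Cyclic monotonicity of Rockafellar for cycles of length three; \<open>c = a\<close> gives ordinary
  monotonicity. For linear maps the ordinary notion admits rotations by a right angle, while the
  cyclic one excludes them.
\<close>

definition three_cyclic_monotone :: "('a::real_inner \<Rightarrow> 'a) \<Rightarrow> bool" where
  "three_cyclic_monotone F \<longleftrightarrow>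
     (\<forall>a b c. 0 \<le> F a \<bullet> (a - b) + F b \<bullet> (b - c) + F c \<bullet> (c - a))"

text \<open>
  Sum of the tangent inequalities along the triangle \<open>G a\<close>, \<open>G b\<close>, \<open>G c\<close>: the values of \<open>f\<close>
  cancel.
\<close>

lemma subgradient_inverse_three_cyclic_monotone:
  assumes tangent: "\<And>x y. f x + g x \<bullet> (y - x) \<le> f y" and G: "\<And>p. g (G p) = p"
  shows "three_cyclic_monotone G"
  unfolding three_cyclic_monotone_def
proof (intro allI)
  fix a b c
  show "0 \<le> G a \<bullet> (a - b) + G b \<bullet> (b - c) + G c \<bullet> (c - a)"
    using tangent[of "G a" "G c"] tangent[of "G b" "G a"] tangent[of "G c" "G b"]
    by (simp add: G inner_diff_right inner_commute)
qed

text \<open>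
  This is the cyclic inequality for the triangle \<open>x + s h\<close>, \<open>x + s k\<close>, \<open>x\<close>, divided by \<open>s\<^sup>2\<close>,
  in the limit \<open>s \<rightarrow> 0\<close>.
\<close>

lemma three_cyclic_monotone_derivative:
  assumes mono: "three_cyclic_monotone F" and d: "(F has_derivative A) (at x)"
  shows "0 \<le> A h \<bullet> (h - k) + A k \<bullet> k"
proof -
  have slope: "((\<lambda>s. (F (x + s *\<^sub>R v) - F x) \<bullet> w / s) \<longlongrightarrow> A v \<bullet> w) (at 0)" for v w
  proof -
    have "((\<lambda>s. x + s *\<^sub>R v) has_derivative (\<lambda>s. s *\<^sub>R v)) (at 0)"
      by (auto intro!: derivative_eq_intros)
    moreover have "(F has_derivative A) (at (x + 0 *\<^sub>R v))" using d by simp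
    ultimately have "((\<lambda>s. F (x + s *\<^sub>R v)) has_derivative (\<lambda>s. A (s *\<^sub>R v))) (at 0)"
      by (rule has_derivative_compose)
    then have "((\<lambda>s. F (x + s *\<^sub>R v) \<bullet> w) has_derivative (\<lambda>s. A (s *\<^sub>R v) \<bullet> w)) (at 0)"
      by (rule has_derivative_inner_left)
    then have "((\<lambda>s. F (x + s *\<^sub>R v) \<bullet> w) has_real_derivative A v \<bullet> w) (at 0)"
      by (rule has_derivative_imp_has_field_derivative)
        (simp add: linear_scale[OF has_derivative_linear[OF d]])
    then show ?thesis by (simp add: DERIV_def inner_diff_left)
  qed
  have "0 \<le> (F (x + s *\<^sub>R h) - F x) \<bullet> (h - k) / s + (F (x + s *\<^sub>R k) - F x) \<bullet> k / s"
    if "s \<noteq> 0" for s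
  proof -
    have "0 \<le> F (x + s *\<^sub>R h) \<bullet> (s *\<^sub>R h - s *\<^sub>R k) + F (x + s *\<^sub>R k) \<bullet> (s *\<^sub>R k) - F x \<bullet> (s *\<^sub>R h)"
      using mono[unfolded three_cyclic_monotone_def, rule_format, of "x + s *\<^sub>R h" "x + s *\<^sub>R k" x]
      by simp
    also have "\<dots> = s * s * ((F (x + s *\<^sub>R h) - F x) \<bullet> (h - k) / s + (F (x + s *\<^sub>R k) - F x) \<bullet> k / s)"
      using that by (simp add: field_simps inner_diff_left inner_diff_right)
    finally show ?thesis
      using that by (simp add: zero_le_mult_iff) (metis not_real_square_gt_zero not_less order.asym)
  qed
  then show ?thesis
    by (intro tendsto_lowerbound[OF tendsto_add[OF slope[of h "h - k"] slope[of k k]]])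
      (auto simp: eventually_at_filter)
qed

lemma three_cyclic_monotone_derivative_nonneg:
  assumes "three_cyclic_monotone F" and "(F has_derivative A) (at x)"
  shows "0 \<le> A h \<bullet> h"
  using three_cyclic_monotone_derivative[OF assms, of h 0]
  by (simp add: linear_0[OF has_derivative_linear[OF assms(2)]])

text \<open>
  With \<open>A h \<bullet> h = 0\<close>, the infinitesimal inequality for \<open>k = t A h\<close> bounds \<open>t (norm (A h))\<^sup>2\<close>
  by a multiple of \<open>t\<^sup>2\<close>, which for small positive \<open>t\<close> is possible only if \<open>A h = 0\<close>.
\<close>

lemma three_cyclic_monotone_derivative_definite:
  assumes mono: "three_cyclic_monotone F" and d: "(F has_derivative A) (at x)"
    and zero: "A h \<bullet> h = 0"
  shows "A h = 0"
proof -
  let ?k = "A h"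
  have "t * (A h \<bullet> ?k) \<le> t * (t * (A ?k \<bullet> ?k))" for t
    using three_cyclic_monotone_derivative[OF mono d, of h "t *\<^sub>R ?k"] zero
    by (simp add: inner_diff_right linear_scale[OF has_derivative_linear[OF d]])
  then have *: "A h \<bullet> ?k \<le> t * (A ?k \<bullet> ?k)" if "0 < t" for t
    using that by (metis mult_le_cancel_left_pos)
  have "((\<lambda>t. t * (A ?k \<bullet> ?k)) \<longlongrightarrow> 0 * (A ?k \<bullet> ?k)) (at_right 0)"
    by (intro tendsto_intros)
  then have "A h \<bullet> ?k \<le> 0 * (A ?k \<bullet> ?k)"
    by (rule tendsto_lowerbound) (use * in \<open>auto simp: eventually_at_filter\<close>)
  then show ?thesis using inner_gt_zero_iff[of "A h"] by fastforce
qed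

section \<open>Infimal convolution of simple convex functions\<close>

theorem lemma2p16:
  fixes f1 f2 :: "real ^ 'n \<Rightarrow> real"
  assumes "smooth f1" and "simple f1" and "convex_on UNIV f1"
    and "smooth f2" and "simple f2" and "convex_on UNIV f2"
  shows "infconv_finite f1 f2
    \<and> smooth (infconv f1 f2) \<and> simple (infconv f1 f2) \<and> convex_on UNIV (infconv f1 f2)
    \<and> jet_conv (one_graph f1) (one_graph f2) = one_graph (infconv f1 f2)"
proof -
  let ?f = "infconv f1 f2"
  define G1 where "G1 = inv (gradient f1)"
  define G2 where "G2 = inv (gradient f2)"
  define H where "H p = G1 p + G2 p" for p
  define K where "K = inv H"
  note d1 = smooth_imp_GDERIV[OF assms(1)] and d2 = smooth_imp_GDERIV[OF assms(4)]
  note tangent1 = convex_above_tangent[OF assms(3) d1]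
    and tangent2 = convex_above_tangent[OF assms(6) d2]
  have bij1: "bij (gradient f1)" and bij2: "bij (gradient f2)"
    and smoothG1: "smooth G1" and smoothG2: "smooth G2"
    using assms(2,5) by (simp_all add: simple_def diffeomorphism_def G1_def G2_def)
  have g1G: "gradient f1 (G1 p) = p" and Gg1: "G1 (gradient f1 x) = x"
    and g2G: "gradient f2 (G2 p) = p" and Gg2: "G2 (gradient f2 x) = x" for p x
    using bij1 bij2 by (simp_all add: G1_def G2_def bij_is_surj surj_f_inv_f bij_is_inj)
  have CkG: "Ck k G1" "Ck k G2" and Ckf: "Ck k f1" "Ck k f2" for k
    using smoothG1 smoothG2 assms(1,4) by (simp_all add: smooth_def)

  have smoothH: "smooth H"
    unfolding H_def smooth_def using CkG by (auto intro: Ck_add)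
  have "inj H"
  proof (rule injI, rule ccontr)
    fix p p' assume eq: "H p = H p'" and ne: "p \<noteq> p'"
    have "G1 p \<noteq> G1 p'" "G2 p \<noteq> G2 p'" using ne g1G g2G by metis+
    with injective_gradient_strict_mono[OF tangent1 d1 bij_is_inj[OF bij1], of "G1 p" "G1 p'"]
      injective_gradient_strict_mono[OF tangent2 d2 bij_is_inj[OF bij2], of "G2 p" "G2 p'"]
    have "0 < (p - p') \<bullet> (H p - H p')"
      by (simp add: g1G g2G H_def inner_diff_right inner_add_right)
    with eq show False by simp
  qed
  moreover have "surj H"
  proof -
    obtain c1 where c1: "\<And>x. norm x - c1 \<le> f1 x"
      using surjective_subgradient_coercive[of f1 "gradient f1" G1, OF tangent1 g1G] Ckf[of 0] CkG[of 0] by auto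
    obtain c2 where c2: "\<And>x. norm x - c2 \<le> f2 x"
      using surjective_subgradient_coercive[of f2 "gradient f2" G2, OF tangent2 g2G] Ckf[of 0] CkG[of 0] by auto
    have "\<exists>p. H p = q" for q
    proof -
      obtain v where v: "gradient f1 v = gradient f2 (q - v)"
        using infconv_critical_point_exists[OF d1 d2 c1 c2] by metis
      have "H (gradient f1 v) = G1 (gradient f1 v) + G2 (gradient f2 (q - v))"
        by (simp add: H_def v)
      then show ?thesis by (auto simp: Gg1 Gg2)
    qed
    then show ?thesis by (metis surjI)
  qed
  ultimately have bijH: "bij H" by (simp add: bij_def)
  have HK: "H (K q) = q" and KH: "K (H p) = p" for p q
    using bijH by (simp_all add: K_def bij_is_surj surj_f_inv_f bij_is_inj)

  have "frechet_derivative H (at p) h = 0 \<Longrightarrow> h = 0" for p h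
  proof -
    assume zero: "frechet_derivative H (at p) h = 0"
    let ?B1 = "frechet_derivative G1 (at p)" and ?B2 = "frechet_derivative G2 (at p)"
    have dG1: "(G1 has_derivative ?B1) (at p)" and dG2: "(G2 has_derivative ?B2) (at p)"
      using CkG by (auto intro: Ck_Suc_has_derivative)
    have mono1: "three_cyclic_monotone G1" and mono2: "three_cyclic_monotone G2"
      using subgradient_inverse_three_cyclic_monotone[of f1 "gradient f1" G1, OF tangent1 g1G]
        subgradient_inverse_three_cyclic_monotone[of f2 "gradient f2" G2, OF tangent2 g2G] by auto
    have "(H has_derivative (\<lambda>h. ?B1 h + ?B2 h)) (at p)"
      unfolding H_def using dG1 dG2 by (rule has_derivative_add)
    then have "frechet_derivative H (at p) = (\<lambda>h. ?B1 h + ?B2 h)"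
      by (rule frechet_derivative_at[symmetric])
    with zero have "?B1 h + ?B2 h = 0" by simp
    then have "?B1 h \<bullet> h + ?B2 h \<bullet> h = 0" by (simp add: inner_left_distrib[symmetric])
    then have "?B1 h \<bullet> h = 0"
      using three_cyclic_monotone_derivative_nonneg[OF mono1 dG1, of h]
        three_cyclic_monotone_derivative_nonneg[OF mono2 dG2, of h] by linarith
    then have B1h: "?B1 h = 0" by (rule three_cyclic_monotone_derivative_definite[OF mono1 dG1])
    have "Ck 1 (gradient f1)"
      using assms(2) by (simp add: simple_def diffeomorphism_def smooth_def)
    then have dg: "(gradient f1 has_derivative frechet_derivative (gradient f1) (at (G1 p))) (at (G1 p))"
      by (intro Ck_Suc_has_derivative[of 0]) simp
    \<comment> \<open>The derivative of \<open>G1\<close> is injective, as \<open>gradient f1\<close> undoes \<open>G1\<close>.\<close>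
    have "((\<lambda>p. p) has_derivative (\<lambda>h. frechet_derivative (gradient f1) (at (G1 p)) (?B1 h))) (at p)"
      using has_derivative_compose[OF dG1 dg] by (simp add: g1G)
    from fun_cong[OF has_derivative_unique[OF this has_derivative_ident], of h]
    have "frechet_derivative (gradient f1) (at (G1 p)) (?B1 h) = h" .
    then show "h = 0"
      using linear_0[OF has_derivative_linear[OF dg]] B1h by simp
  qed
  then have smoothK: "smooth K"
    unfolding K_def using smoothH bijH by (intro smooth_inv)

  \<comment> \<open>The tangents to \<open>f1\<close> at \<open>G1 p\<close> and to \<open>f2\<close> at \<open>G2 p\<close> share the slope \<open>p\<close>, so their sum
    depends on \<open>v + w\<close> only.\<close>
  have lower: "f1 (G1 p) + f2 (G2 p) + p \<bullet> (v + w - H p) \<le> f1 v + f2 w" for p v w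
    using tangent1[of "G1 p" v] tangent2[of "G2 p" w]
    by (simp add: g1G g2G H_def inner_diff_right inner_add_right)
  have G2K: "G2 (K q) = q - G1 (K q)" for q
    using HK[of q] by (simp add: H_def algebra_simps)
  have min: "f1 (G1 (K q)) + f2 (G2 (K q)) \<le> f1 v + f2 (q - v)" for q v
    using lower[of "K q" v "q - v"] by (simp add: HK)
  have fin: "infconv_finite f1 f2"
    unfolding infconv_finite_def
  proof
    show "bdd_below (range (\<lambda>v. f1 v + f2 (q - v)))" for q
      using min by (rule bdd_belowI2)
  qed
  have val: "?f q = f1 (G1 (K q)) + f2 (G2 (K q))" for q
    unfolding infconv_def
  proof (rule cInf_eq_minimum)
    show "f1 (G1 (K q)) + f2 (G2 (K q)) \<in> range (\<lambda>v. f1 v + f2 (q - v))"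
      unfolding G2K by (rule rangeI)
    show "f1 (G1 (K q)) + f2 (G2 (K q)) \<le> x" if "x \<in> range (\<lambda>v. f1 v + f2 (q - v))" for x
      using that min by auto
  qed
  have CkK: "Ck k K" for k using smoothK by (simp add: smooth_def)
  have tangent: "?f x + K x \<bullet> (y - x) \<le> ?f y" for x y
    using lower[of "K x" "G1 (K y)" "G2 (K y)"] by (simp add: val HK G2K)
  have df: "GDERIV ?f q :> K q" for q
  proof -
    let ?v = "\<lambda>q. G1 (K q)"
    let ?M = "frechet_derivative ?v (at q)"
    have "Ck (Suc 0) ?v" by (rule Ck_compose[OF CkG(1) CkK])
    then have dv: "(?v has_derivative ?M) (at q)" by (rule Ck_Suc_has_derivative)
    \<comment> \<open>Written as \<open>q - G1 (K q)\<close>, the second minimiser moves by \<open>h - M h\<close>, so the unknown \<open>M h\<close>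
      cancels from the derivative of the sum.\<close>
    have dw: "((\<lambda>q. G2 (K q)) has_derivative (\<lambda>h. h - ?M h)) (at q)"
      unfolding G2K by (rule has_derivative_diff[OF has_derivative_ident dv])
    have "((\<lambda>q. f1 (?v q) + f2 (G2 (K q))) has_derivative (\<lambda>h. ?M h \<bullet> K q + (h - ?M h) \<bullet> K q)) (at q)"
      using has_derivative_add[OF has_derivative_compose[OF dv d1[of "?v q", unfolded gderiv_def]]
        has_derivative_compose[OF dw d2[of "G2 (K q)", unfolded gderiv_def]]]
      by (simp add: g1G g2G)
    then show ?thesis by (simp add: gderiv_def val[abs_def] inner_diff_left)
  qed
  have grad: "gradient ?f = K" using gradient_eq[OF df] by auto
  have convex: "convex_on UNIV ?f" using tangent by (rule subgradients_imp_convex)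
  have simple: "simple ?f"
    unfolding simple_def grad diffeomorphism_def
    using bijH smoothK smoothH by (simp add: K_def bij_imp_bij_inv inv_inv_eq)
  have smooth: "smooth ?f"
    unfolding smooth_def val[abs_def]
    by (intro allI Ck_add Ck_compose[OF Ckf(1) Ck_compose[OF CkG(1) CkK]]
        Ck_compose[OF Ckf(2) Ck_compose[OF CkG(2) CkK]])
  have jets: "jet_conv (one_graph f1) (one_graph f2) = one_graph ?f"
  proof
    show "jet_conv (one_graph f1) (one_graph f2) \<subseteq> one_graph ?f"
    proof
      fix z assume "z \<in> jet_conv (one_graph f1) (one_graph f2)"
      then obtain q1 q2 p where p: "gradient f1 q1 = p" "gradient f2 q2 = p"
        and z: "z = (f1 q1 + f2 q2, q1 + q2, p)"
        by (auto simp: jet_conv_def one_graph_def)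
      have "q1 = G1 p" "q2 = G2 p" using Gg1[of q1] Gg2[of q2] by (simp_all add: p)
      then have "z = (f1 (G1 p) + f2 (G2 p), H p, p)" by (simp add: z H_def)
      then have "z = (?f (H p), H p, gradient ?f (H p))" by (simp add: val grad KH)
      then show "z \<in> one_graph ?f" by (auto simp: one_graph_def)
    qed
    show "one_graph ?f \<subseteq> jet_conv (one_graph f1) (one_graph f2)"
    proof
      fix z assume "z \<in> one_graph ?f"
      then obtain q where "z = (f1 (G1 (K q)) + f2 (G2 (K q)), G1 (K q) + G2 (K q), K q)"
        using HK by (auto simp: one_graph_def val grad H_def)
      moreover have "(f1 (G1 (K q)), G1 (K q), K q) \<in> one_graph f1"
        unfolding one_graph_def using g1G[of "K q"] by force
      moreover have "(f2 (G2 (K q)), G2 (K q), K q) \<in> one_graph f2"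
        unfolding one_graph_def using g2G[of "K q"] by force
      ultimately show "z \<in> jet_conv (one_graph f1) (one_graph f2)"
        unfolding jet_conv_def by blast
    qed
  qed
  show ?thesis using fin smooth simple convex jets by blast
qed

end
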